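(* For every integer $k\ge 0$, $|I_k(123,231)|$ equals the number of fountains of $k$ coins in which the missing coins with respect to the full triangular fountain (with the same bottom row) form a rectangle, where removing no coins counts as a rectangle. The generating function $\sum_{k\ge 0}|I_k(123,231)|x^k$ is given by \[\sum_{i\ge 1} x^{\binom{i}{2}}+\sum_{i\ge 1}\sum_{j\ge 1}\sum_{\ell=0}^{\min(i,j)-1} x^{\binom{i+1}{2}+\binom{j+1}{2}-\binom{\ell+1}{2}}.\]
   Context: A permutation of length $n$ is a word $\pi=\pi_1\cdots\pi_n$ containing each of $1,\dots,n$ exactly once. The sum of permutations $\rho=\rho_1\cdots\rho_n$ and $\tau=\tau_1\cdots\tau_m$ is the permutation $\rho\oplus\tau=\rho_1\cdots\rho_n(n+\tau_1)\cdots(n+\tau_m)$ of length $n+m$. A permutation is decomposable if it equals $\rho\oplus\tau$ for some non-empty permutations $\rho,\tau$; a non-empty permutation that is not decomposable is indecomposable. An inversion of $\pi$ is a pair $(i,j)$ with $i<j$ and $\pi_i>\pi_j$. A permutation $\pi$ contains a permutation (pattern) $\tau=\tau_1\cdots\tau_m$ if there are indices $i_1<\dots<i_m$ such that $\pi_{i_1},\dots,\pi_{i_m}$ is order-isomorphic to $\tau_1,\dots,\tau_m$; otherwise $\pi$ avoids $\tau$. $I_k(\tau_1,\dots,\tau_r)$ denotes the (finite) set of all indecomposable permutations, of any length, with exactly $k$ inversions that avoid all of $\tau_1,\dots,\tau_r$. A fountain of coins is an arrangement of coins in rows such that the bottom row is full (contiguous, without holes) and each coin in a higher row rests on two adjacent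 coins in the row below. Formally, a fountain with $N\ge 0$ coins in the bottom row is a set $F$ of pairs $(h,p)$ of integers (row $h\ge 0$, position $p$ with $1\le p\le N-h$) such that $(0,p)\in F$ for all $1\le p\le N$, and whenever $(h,p)\in F$ with $h\ge 1$ then $(h-1,p)\in F$ and $(h-1,p+1)\in F$. The empty fountain ($N=0$) is allowed. The full triangular fountain with $N$ coins in the bottom row is the set $T_N$ of all $(h,p)$ with $h\ge 0$, $1\le p\le N-h$. The missing coins of $F$ are the elements of $T_N\setminus F$. The coin $(h,p)$ lies on the up-right diagonal numbered $p$ and on the up-left diagonal numbered $p+h$. A set of coins is a rectangle if it is empty or consists of all coins lying on an up-right diagonal with number in $A$ and an up-left diagonal with number in $B$, for some non-empty intervals of integers $A,B\subseteq\{1,\dots,N\}$ with $a\le b$ for all $a\in A$, $b\in B$. *)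

theory Defs
  imports "HOL-Analysis.Analysis" "HOL-Combinatorics.Multiset_Permutations"
begin

section \<open>Permutations as words\<close>

text \<open>
  A permutation of length \<open>n\<close> is a list containing each of \<open>1, \<dots>, n\<close> exactly once. Its values
  start at 1, while the list positions used below start at 0.
\<close>

definition is_perm :: "nat list \<Rightarrow> bool" where
  "is_perm xs \<longleftrightarrow> xs \<in> permutations_of_set {1..length xs}"

definition perm_sum :: "nat list \<Rightarrow> nat list \<Rightarrow> nat list" where
  "perm_sum \<rho> \<tau> = \<rho> @ map (\<lambda>x. length \<rho> + x) \<tau>"

definition decomposable :: "nat list \<Rightarrow> bool" where
  "decomposable xs \<longleftrightarrow>
     (\<exists>\<rho> \<tau>. is_perm \<rho> \<and> is_perm \<tau> \<and> \<rho> \<noteq> [] \<and> \<tau> \<noteq> [] \<and> xs = perm_sum \<rho> \<tau>)"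

definition indecomposable :: "nat list \<Rightarrow> bool" where
  "indecomposable xs \<longleftrightarrow> is_perm xs \<and> xs \<noteq> [] \<and> \<not> decomposable xs"

definition inversions :: "nat list \<Rightarrow> (nat \<times> nat) set" where
  "inversions xs = {(i, j). i < j \<and> j < length xs \<and> xs ! i > xs ! j}"

text \<open>The function \<open>f\<close> lists the positions at which the pattern occurs.\<close>

definition contains :: "nat list \<Rightarrow> nat list \<Rightarrow> bool" where
  "contains xs \<tau> \<longleftrightarrow>
     (\<exists>f :: nat \<Rightarrow> nat. strict_mono_on {..<length \<tau>} f \<and> f ` {..<length \<tau>} \<subseteq> {..<length xs} \<and>
        (\<forall>a<length \<tau>. \<forall>b<length \<tau>. xs ! f a < xs ! f b \<longleftrightarrow> \<tau> ! a < \<tau> ! b))"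

definition avoids :: "nat list \<Rightarrow> nat list \<Rightarrow> bool" where
  "avoids xs \<tau> \<longleftrightarrow> \<not> contains xs \<tau>"

definition indec_avoiders :: "nat \<Rightarrow> nat list set \<Rightarrow> nat list set" where
  "indec_avoiders k P =
     {xs. indecomposable xs \<and> card (inversions xs) = k \<and> (\<forall>\<tau>\<in>P. avoids xs \<tau>)}"


section \<open>Fountains of coins\<close>

text \<open>
  A coin \<open>(h, p)\<close> sits in row \<open>h\<close> (the bottom row being row 0) at position \<open>p\<close>.
\<close>

definition full_fountain :: "nat \<Rightarrow> (nat \<times> nat) set" where
  "full_fountain N = {(h, p). 1 \<le> p \<and> p + h \<le> N}"

definition is_fountain :: "nat \<Rightarrow> (nat \<times> nat) set \<Rightarrow> bool" where
  "is_fountain N F \<longleftrightarrow>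
     F \<subseteq> full_fountain N \<and>
     (\<forall>p\<in>{1..N}. (0, p) \<in> F) \<and>
     (\<forall>h p. (h, p) \<in> F \<and> h \<ge> 1 \<longrightarrow> (h - 1, p) \<in> F \<and> (h - 1, p + 1) \<in> F)"

text \<open>
  The coin \<open>(h, p)\<close> lies on the up-right diagonal \<open>p\<close> and on the up-left diagonal \<open>p + h\<close>. The
  non-empty intervals of diagonals are \<open>{a\<^sub>1..a\<^sub>2}\<close> and \<open>{b\<^sub>1..b\<^sub>2}\<close>; the condition \<open>a\<^sub>2 \<le> b\<^sub>1\<close> says that
  every element of the former is at most every element of the latter.
\<close>

definition is_rectangle :: "nat \<Rightarrow> (nat \<times> nat) set \<Rightarrow> bool" where
  "is_rectangle N R \<longleftrightarrow>
     R = {} \<or>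
     (\<exists>a\<^sub>1 a\<^sub>2 b\<^sub>1 b\<^sub>2. 1 \<le> a\<^sub>1 \<and> a\<^sub>1 \<le> a\<^sub>2 \<and> a\<^sub>2 \<le> b\<^sub>1 \<and> b\<^sub>1 \<le> b\<^sub>2 \<and> b\<^sub>2 \<le> N \<and>
        R = {(h, p). p \<in> {a\<^sub>1..a\<^sub>2} \<and> p + h \<in> {b\<^sub>1..b\<^sub>2}})"

text \<open>
  Since the bottom row of a fountain is full, the number \<open>N\<close> is determined by \<open>F\<close>.
\<close>

definition rectangle_fountains :: "nat \<Rightarrow> (nat \<times> nat) set set" where
  "rectangle_fountains k =
     {F. card F = k \<and> (\<exists>N. is_fountain N F \<and> is_rectangle N (full_fountain N - F))}"


section \<open>Finiteness of the counted sets\<close>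

lemma finite_full_fountain: "finite (full_fountain N)"
  by (rule finite_subset[of _ "{..N} \<times> {..N}"]) (auto simp: full_fountain_def)

lemma is_fountain_bottom_le_card:
  assumes "is_fountain N F"
  shows "N \<le> card F"
proof -
  have "finite F"
    using assms finite_full_fountain finite_subset unfolding is_fountain_def by blast
  moreover have "Pair 0 ` {1..N} \<subseteq> F"
    using assms by (auto simp: is_fountain_def)
  ultimately have "card (Pair (0::nat) ` {1..N}) \<le> card F"
    by (rule card_mono)
  moreover have "card (Pair (0::nat) ` {1..N}) = N"
    by (subst card_image) (auto simp: inj_on_def)
  ultimately show ?thesis by simp
qed

lemma finite_rectangle_fountains: "finite (rectangle_fountains k)"
proof (rule finite_subset)
  show "rectangle_fountains k \<subseteq> (\<Union>N\<le>k. Pow (full_fountain N))"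
  proof
    fix F assume "F \<in> rectangle_fountains k"
    then obtain N where "is_fountain N F" "card F = k"
      unfolding rectangle_fountains_def by blast
    moreover from this have "N \<le> k" "F \<subseteq> full_fountain N"
      using is_fountain_bottom_le_card by (auto simp: is_fountain_def)
    ultimately show "F \<in> (\<Union>N\<le>k. Pow (full_fountain N))" by blast
  qed
  show "finite (\<Union>N\<le>k. Pow (full_fountain N))"
    by (auto simp: finite_full_fountain)
qed

lemma decomposable_if_prefix:
  assumes "is_perm xs" "0 < m" "m < length xs" "set (take m xs) = {1..m}"
  shows "decomposable xs"
proof -
  let ?n = "length xs"
  have d: "distinct xs" and s: "set xs = {1..?n}"
    using assms(1) by (auto simp: is_perm_def dest: permutations_of_setD)
  have disj: "set (take m xs) \<inter> set (drop m xs) = {}"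
    using d by (simp add: set_take_disj_set_drop_if_distinct)
  have "set (take m xs) \<union> set (drop m xs) = {1..?n}"
    using s set_append[of "take m xs" "drop m xs"] by simp
  hence "set (drop m xs) = {1..?n} - {1..m}"
    using disj unfolding assms(4) by blast
  also have "\<dots> = {m+1..?n}"
    by (rule set_eqI, unfold Diff_iff atLeastAtMost_iff) linarith
  finally have sd: "set (drop m xs) = {m+1..?n}" .
  define \<tau> where "\<tau> = map (\<lambda>x. x - m) (drop m xs)"
  have "set \<tau> = {1..?n - m}"
  proof -
    have "set \<tau> = (\<lambda>x. x - m) ` {m+1..?n}"
      unfolding \<tau>_def set_map sd ..
    also have "\<dots> = {1..?n - m}"
    proof safe
      fix y assume "y \<in> {1..?n - m}"
      thus "y \<in> (\<lambda>x. x - m) ` {m+1..?n}"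
        by (intro image_eqI[of _ _ "y + m"]) auto
    qed auto
    finally show ?thesis .
  qed
  moreover have "inj_on (\<lambda>x. x - m) (set (drop m xs))"
    unfolding sd by (auto simp: inj_on_def)
  hence "distinct \<tau>"
    using d by (simp add: \<tau>_def distinct_map)
  moreover have "length \<tau> = ?n - m" by (simp add: \<tau>_def)
  ultimately have "is_perm \<tau>"
    by (auto simp: is_perm_def intro: permutations_of_setI)
  moreover have "is_perm (take m xs)"
    using assms d by (auto simp: is_perm_def min_def intro!: permutations_of_setI)
  moreover have "map (\<lambda>x. m + x) \<tau> = drop m xs"
    using sd by (auto simp: \<tau>_def intro!: map_idI)
  hence "xs = perm_sum (take m xs) \<tau>"
    using assms(3) by (simp add: perm_sum_def min_def)
  moreover have "take m xs \<noteq> []" "\<tau> \<noteq> []"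
    using assms by (auto simp: \<tau>_def)
  ultimately show ?thesis
    unfolding decomposable_def by blast
qed

lemma indecomposable_index_in_inversion:
  assumes "indecomposable xs" "length xs \<ge> 2" "i < length xs"
  shows "i \<in> fst ` inversions xs \<union> snd ` inversions xs"
proof (rule ccontr)
  assume no: "\<not> ?thesis"
  let ?n = "length xs"
  have perm: "is_perm xs" and nd: "\<not> decomposable xs"
    using assms(1) by (auto simp: indecomposable_def)
  have d: "distinct xs" and s: "set xs = {1..?n}"
    using perm by (auto simp: is_perm_def dest: permutations_of_setD)
  have below: "xs ! j < xs ! i" if "j < i" for j
  proof -
    have "(j, i) \<notin> inversions xs" using no by force
    moreover have "xs ! j \<noteq> xs ! i" using d that assms(3) by (simp add: nth_eq_iff_index_eq)
    ultimately show ?thesis using that assms(3) by (auto simp: inversions_def)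
  qed
  have above: "xs ! i < xs ! j" if "i < j" "j < ?n" for j
  proof -
    have "(i, j) \<notin> inversions xs" using no by force
    moreover have "xs ! j \<noteq> xs ! i" using d that assms(3) by (simp add: nth_eq_iff_index_eq)
    ultimately show ?thesis using that by (auto simp: inversions_def)
  qed
  have t: "set (take m xs) = {xs ! j |j. j < m}" if "m \<le> ?n" for m
    unfolding nth_image[OF that, symmetric] by auto
  have img: "set (take (Suc i) xs) = {1..xs ! i}"
  proof (intro equalityI subsetI)
    fix x assume "x \<in> set (take (Suc i) xs)"
    then obtain j where j: "x = xs ! j" "j < Suc i" using t[of "Suc i"] assms(3) by auto
    hence "x \<in> {1..?n}" using s assms(3) by (metis Suc_leI less_le_trans nth_mem)
    moreover have "x \<le> xs ! i" using j below[of j] by (cases "j = i") auto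
    ultimately show "x \<in> {1..xs ! i}" by simp
  next
    fix x assume x: "x \<in> {1..xs ! i}"
    moreover have "xs ! i \<in> {1..?n}" using s assms(3) by (metis nth_mem)
    ultimately have "x \<in> set xs" by (simp add: s)
    then obtain j where j: "j < ?n" "x = xs ! j" by (auto simp: in_set_conv_nth)
    hence "j < Suc i" using above[of j] x by (cases "i < j") auto
    thus "x \<in> set (take (Suc i) xs)" using t[of "Suc i"] j assms(3) by auto
  qed
  have "card (set (take (Suc i) xs)) = Suc i"
    using d assms(3) by (subst distinct_card) auto
  hence val: "xs ! i = Suc i" by (simp add: img)
  show False
  proof (cases "Suc i < ?n")
    case True
    thus False using decomposable_if_prefix[OF perm _ True] img val nd by auto
  next
    case False
    hence i: "i > 0" using assms(2) by auto
    have "take (Suc i) xs = take i xs @ [xs ! i]"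
      using assms(3) by (rule take_Suc_conv_app_nth)
    moreover have "distinct (take (Suc i) xs)" using d by simp
    ultimately have "set (take i xs) = {1..Suc i} - {Suc i}"
      using img val by auto
    also have "\<dots> = {1..i}" by (rule set_eqI) auto
    finally have "set (take i xs) = {1..i}" .
    thus False using decomposable_if_prefix[OF perm i assms(3)] nd by auto
  qed
qed

lemma finite_inversions: "finite (inversions xs)"
  by (rule finite_subset[of _ "{..<length xs} \<times> {..<length xs}"]) (auto simp: inversions_def)

lemma indecomposable_length_le:
  assumes "indecomposable xs"
  shows "length xs \<le> 2 * card (inversions xs) + 1"
proof (cases "length xs \<ge> 2")
  case True
  let ?I = "inversions xs"
  have "{..<length xs} \<subseteq> fst ` ?I \<union> snd ` ?I"
    using indecomposable_index_in_inversion[OF assms True] by blast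
  hence "card {..<length xs} \<le> card (fst ` ?I \<union> snd ` ?I)"
    by (rule card_mono[rotated]) (simp add: finite_inversions)
  also have "\<dots> \<le> card (fst ` ?I) + card (snd ` ?I)" by (rule card_Un_le)
  also have "\<dots> \<le> card ?I + card ?I"
    by (intro add_mono card_image_le finite_inversions)
  finally show ?thesis by simp
qed simp

lemma finite_indec_avoiders: "finite (indec_avoiders k P)"
proof (rule finite_subset)
  show "indec_avoiders k P \<subseteq> (\<Union>n\<le>2 * k + 1. permutations_of_set {1..n})"
  proof
    fix xs assume "xs \<in> indec_avoiders k P"
    hence "indecomposable xs" "card (inversions xs) = k" by (auto simp: indec_avoiders_def)
    thus "xs \<in> (\<Union>n\<le>2 * k + 1. permutations_of_set {1..n})"
      using indecomposable_length_le[of xs] by (auto simp: indecomposable_def is_perm_def)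
  qed
qed auto


section \<open>Convergence of the series\<close>

text \<open>
  The infinite sums occurring in the generating function converge in the usual topology of formal
  power series.
\<close>

lemma fps_summable_onI:
  fixes F :: "'a \<Rightarrow> int fps"
  assumes "\<And>n. finite {x\<in>A. fps_nth (F x) n \<noteq> 0}"
  shows "F summable_on A"
proof -
  have "(F has_sum Abs_fps (\<lambda>n. \<Sum>x | x \<in> A \<and> fps_nth (F x) n \<noteq> 0. fps_nth (F x) n)) A"
    by (rule has_sum_fpsI) (use assms in auto)
  thus ?thesis by (rule has_sum_imp_summable)
qed

lemma fps_infsum_nth:
  fixes F :: "'a \<Rightarrow> int fps"
  assumes "F summable_on A"
  shows "fps_nth (infsum F A) n = (\<Sum>x | x \<in> A \<and> fps_nth (F x) n \<noteq> 0. fps_nth (F x) n)"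
  using has_sum_fpsD(2) has_sum_infsum[OF assms] by blast

lemma le_Suc_choose_2: "i \<le> Suc i choose 2"
proof (induction i)
  case (Suc i)
  have "Suc (Suc i) choose 2 = Suc i + (Suc i choose 2)"
    by (simp add: numeral_2_eq_2)
  thus ?case by linarith
qed simp

lemma summable_first_series:
  "(\<lambda>i. fps_X ^ (i choose 2) :: int fps) summable_on {1..}"
proof (rule fps_summable_onI)
  fix n
  have "i \<le> Suc n" if "n = i choose 2" for i
    using that le_Suc_choose_2[of "i - 1"] by (cases i) auto
  hence "{i\<in>{1..}. fps_nth (fps_X ^ (i choose 2) :: int fps) n \<noteq> 0} \<subseteq> {..Suc n}"
    by (auto simp: fps_X_power_nth split: if_splits)
  thus "finite {i\<in>{1..}. fps_nth (fps_X ^ (i choose 2) :: int fps) n \<noteq> 0}"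
    by (rule finite_subset) simp
qed

definition inner_term :: "nat \<Rightarrow> nat \<Rightarrow> int fps" where
  "inner_term i j = (\<Sum>l = 0..min i j - 1.
     fps_X ^ ((i + 1 choose 2) + (j + 1 choose 2) - (l + 1 choose 2)))"

lemma inner_term_nth_eq_0:
  assumes "i \<ge> 1" "j \<ge> 1" "n < max i j"
  shows "fps_nth (inner_term i j) n = 0"
proof -
  have "n \<noteq> (i + 1 choose 2) + (j + 1 choose 2) - (l + 1 choose 2)" if "l \<le> min i j - 1" for l
  proof -
    have "l + 1 choose 2 \<le> min (i + 1 choose 2) (j + 1 choose 2)"
      using that by (intro min.boundedI binomial_right_mono) auto
    thus ?thesis
      using assms(3) le_Suc_choose_2[of i] le_Suc_choose_2[of j] by auto
  qed
  thus ?thesis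
    by (auto simp: inner_term_def fps_sum_nth fps_X_power_nth intro!: sum.neutral)
qed

lemma summable_inner_series:
  assumes "i \<ge> 1"
  shows "inner_term i summable_on {1..}"
proof (rule fps_summable_onI)
  fix n
  have "{j\<in>{1..}. fps_nth (inner_term i j) n \<noteq> 0} \<subseteq> {..n}"
  proof
    fix j assume "j \<in> {j\<in>{1..}. fps_nth (inner_term i j) n \<noteq> 0}"
    hence "j \<ge> 1" "fps_nth (inner_term i j) n \<noteq> 0" by simp_all
    hence "\<not> n < max i j" using inner_term_nth_eq_0[OF assms] by blast
    thus "j \<in> {..n}" by simp
  qed
  thus "finite {j\<in>{1..}. fps_nth (inner_term i j) n \<noteq> 0}"
    by (rule finite_subset) simp
qed

lemma summable_outer_series:
  "(\<lambda>i. \<Sum>\<^sub>\<infinity>j\<in>{1..}. inner_term i j) summable_on {1..}"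
proof (rule fps_summable_onI)
  fix n
  have "fps_nth (\<Sum>\<^sub>\<infinity>j\<in>{1..}. inner_term i j) n = 0" if "i \<ge> 1" "n < i" for i
    unfolding fps_infsum_nth[OF summable_inner_series[OF that(1)]]
    using that by (intro sum.neutral) (auto simp: inner_term_nth_eq_0)
  hence "{i\<in>{1..}. fps_nth (\<Sum>\<^sub>\<infinity>j\<in>{1..}. inner_term i j) n \<noteq> 0} \<subseteq> {..n}"
    by (metis (mono_tags, lifting) atLeast_iff atMost_iff mem_Collect_eq not_le subsetI)
  thus "finite {i\<in>{1..}. fps_nth (\<Sum>\<^sub>\<infinity>j\<in>{1..}. inner_term i j) n \<noteq> 0}"
    by (rule finite_subset) simp
qed

end

theory Submission
  imports Defs
begin

text \<open>
  Indecomposable avoiders and fountains are both parametrised by triples \<open>(n, a, c)\<close> with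
  \<open>a + c < n\<close> and either \<open>a = c = 0\<close> or \<open>a, c \<ge> 1\<close>; in both cases the object counted at
  \<open>(n, a, c)\<close> has size \<open>(n choose 2) - a * c\<close>.

  Let \<open>\<pi>\<close> be a permutation of length \<open>n\<close> avoiding 123 and 231. If its largest entry \<open>n\<close> comes
  first, what follows is an arbitrary avoider of length \<open>n - 1\<close>. Otherwise, the entries before
  \<open>n\<close> decrease (no 123), they are smaller than the entries after \<open>n\<close> (no 231), and so the entries
  after \<open>n\<close> also decrease (no 123). Hence \<open>\<pi>\<close> consists of three decreasing runs: the entries
  larger than \<open>a + c\<close>, then those from \<open>a\<close> down to 1, then those from \<open>a + c\<close> down to \<open>a + 1\<close>. It
  is indecomposable iff the first run is non-empty, and the non-inverted pairs are those with one
  index in each of the last two runs, so there are \<open>(n choose 2) - a * c\<close> inversions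
  (\<open>indecomposable_avoider_is_block_word\<close>, \<open>card_inversions_block_word\<close>).

  In a fountain with bottom row of length \<open>n - 1\<close> the missing coins are closed under going up. A
  non-empty rectangle of missing coins therefore reaches the apex of the triangle, and is given by
  the first \<open>a\<close> up-right and the last \<open>c\<close> up-left diagonals; it misses the bottom row iff
  \<open>a + c < n\<close> (\<open>rectangle_fountain_is_cut_fountain\<close>).

  As for the generating function, the triples with \<open>a = c = 0\<close> give the first series. For the
  others, the fountain is the union of two full triangles with bottom rows of lengths
  \<open>i = l + a\<close> and \<open>j = l + c\<close>, which overlap in a triangle with bottom row of length
  \<open>l = n - 1 - a - c\<close>; inclusion-exclusion gives the exponent in the second series
  (\<open>card_params_of_weight\<close>).
\<close>


section \<open>The common parameters\<close>

text \<open>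
  The parameters of an indecomposable avoider of length \<open>n\<close>, equivalently of a fountain with
  \<open>n - 1\<close> coins in the bottom row and \<open>a * c\<close> missing coins. Requiring \<open>a = 0 \<longleftrightarrow> c = 0\<close> gives the
  degenerate case a unique representation.
\<close>

definition block_params :: "(nat \<times> nat \<times> nat) set" where
  "block_params = {(n, a, c). a + c < n \<and> (a = 0 \<longleftrightarrow> c = 0)}"

text \<open>The weight is the number of inversions of the permutation and of coins of the fountain.\<close>

definition params_of_weight :: "nat \<Rightarrow> (nat \<times> nat \<times> nat) set" where
  "params_of_weight k = {(n, a, c). (n, a, c) \<in> block_params \<and> (n choose 2) - a * c = k}"

lemma Suc_choose_two: "Suc n choose 2 = n + (n choose 2)"
  by (simp add: numeral_2_eq_2)

lemma add_choose_two: "(x + y) choose 2 = (x choose 2) + (y choose 2) + x * y"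
  by (induction y) (simp_all add: Suc_choose_two)


section \<open>Patterns of length three\<close>

text \<open>Replaces the position function of an occurrence by its three values.\<close>

lemma contains_3_iff:
  "contains xs [u, v, w] \<longleftrightarrow>
    (\<exists>i j k. i < j \<and> j < k \<and> k < length xs \<and>
      (\<forall>a<3. \<forall>b<3. xs ! ([i, j, k] ! a) < xs ! ([i, j, k] ! b) \<longleftrightarrow> [u, v, w] ! a < [u, v, w] ! b))"
  (is "?L \<longleftrightarrow> ?R")
proof -
  have len: "length [u, v, w] = 3" by simp
  show ?thesis
  proof
    assume ?L
    then obtain f :: "nat \<Rightarrow> nat" where f: "strict_mono_on {..<3} f" "f ` {..<3} \<subseteq> {..<length xs}"
        "\<forall>a<3. \<forall>b<3. xs ! f a < xs ! f b \<longleftrightarrow> [u, v, w] ! a < [u, v, w] ! b"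
      unfolding contains_def len by blast
    have "f 0 < f 1" "f 1 < f 2"
      using f(1) by (auto simp: strict_mono_on_def)
    moreover have "f 2 < length xs" using f(2) by (auto simp: image_subset_iff)
    moreover have "[f 0, f 1, f 2] ! a = f a" if "a < 3" for a
      using that by (auto simp: less_Suc_eq numeral_3_eq_3 numeral_2_eq_2)
    ultimately show ?R using f(3) by (intro exI[of _ "f 0"] exI[of _ "f 1"] exI[of _ "f 2"]) simp
  next
    assume ?R
    then obtain i j k where ijk: "i < j" "j < k" "k < length xs"
        "\<forall>a<3. \<forall>b<3. xs ! ([i, j, k] ! a) < xs ! ([i, j, k] ! b) \<longleftrightarrow> [u, v, w] ! a < [u, v, w] ! b"
      by blast
    have "strict_mono_on {..<3} (\<lambda>a. [i, j, k] ! a)"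
      using ijk by (auto simp: strict_mono_on_def less_Suc_eq numeral_3_eq_3)
    moreover have "(\<lambda>a. [i, j, k] ! a) ` {..<3} \<subseteq> {..<length xs}"
      using ijk by (auto simp: less_Suc_eq numeral_3_eq_3)
    ultimately show ?L unfolding contains_def len using ijk(4)
      by (intro exI[of _ "\<lambda>a. [i, j, k] ! a"]) simp
  qed
qed

lemma contains_123_iff:
  "contains xs [1, 2, 3] \<longleftrightarrow>
    (\<exists>i j k. i < j \<and> j < k \<and> k < length xs \<and> xs ! i < xs ! j \<and> xs ! j < xs ! k)"
  unfolding contains_3_iff
  by (intro ex_cong1 conj_cong refl) (auto simp: numeral_3_eq_3 All_less_Suc)

lemma contains_231_iff:
  "contains xs [2, 3, 1] \<longleftrightarrow>
    (\<exists>i j k. i < j \<and> j < k \<and> k < length xs \<and> xs ! k < xs ! i \<and> xs ! i < xs ! j)"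
  unfolding contains_3_iff
  by (intro ex_cong1 conj_cong refl) (auto simp: numeral_3_eq_3 All_less_Suc)


section \<open>Counting inversions\<close>

lemma card_inversions_Cons:
  "card (inversions (x # xs)) = length (filter (\<lambda>y. y < x) xs) + card (inversions xs)"
proof -
  let ?A = "(\<lambda>j. (0::nat, Suc j)) ` {j. j < length xs \<and> xs ! j < x}"
  let ?B = "(\<lambda>(i, j). (Suc i, Suc j)) ` inversions xs"
  have "inversions (x # xs) = ?A \<union> ?B"
  proof (intro equalityI subsetI)
    fix q assume q: "q \<in> inversions (x # xs)"
    obtain i j where ij: "q = (i, j)" by (cases q)
    then obtain j' where "j = Suc j'" using q by (cases j) (auto simp: inversions_def)
    then show "q \<in> ?A \<union> ?B"
      using q ij by (cases i) (auto simp: inversions_def image_iff)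
  qed (auto simp: inversions_def)
  moreover have "?A \<inter> ?B = {}" by auto
  moreover have "card ?A = length (filter (\<lambda>y. y < x) xs)"
    by (subst card_image) (auto simp: inj_on_def length_filter_conv_card)
  moreover have "card ?B = card (inversions xs)"
    by (rule card_image) (auto simp: inj_on_def)
  ultimately show ?thesis
    by (simp add: card_Un_disjoint finite_inversions)
qed

lemma card_inversions_append:
  "card (inversions (xs @ ys)) =
    card (inversions xs) + card (inversions ys) + (\<Sum>x\<leftarrow>xs. length (filter (\<lambda>y. y < x) ys))"
  by (induction xs) (simp_all add: card_inversions_Cons, simp add: inversions_def)

lemma card_inversions_decreasing:
  "sorted_wrt (>) xs \<Longrightarrow> card (inversions xs) = length xs choose 2"
proof (induction xs)
  case Nil
  then show ?case by (simp add: inversions_def)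
next
  case (Cons x xs)
  then have "filter (\<lambda>y. y < x) xs = xs" by (intro filter_True) auto
  then show ?case using Cons by (simp add: card_inversions_Cons Suc_choose_two)
qed

lemma sum_list_filter_greater:
  "(\<forall>x\<in>set xs. \<forall>y\<in>set ys. y < x) \<Longrightarrow>
    (\<Sum>x\<leftarrow>xs. length (filter (\<lambda>y. y < x) ys)) = length xs * length (ys :: nat list)"
proof (induction xs)
  case (Cons x xs)
  then have "filter (\<lambda>y. y < x) ys = ys" by (intro filter_True) auto
  then show ?case using Cons by simp
qed simp

lemma sum_list_filter_less:
  "(\<forall>x\<in>set xs. \<forall>y\<in>set ys. x < y) \<Longrightarrow>
    (\<Sum>x\<leftarrow>xs. length (filter (\<lambda>y. y < x) ys)) = (0 :: nat)"
  for xs ys :: "nat list"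
  by (induction xs) (auto simp: filter_empty_conv)


section \<open>The indecomposable avoiders\<close>

text \<open>
  The permutation of length \<open>n\<close> made of three decreasing runs, with values \<open>{a+c+1..n}\<close>, \<open>{1..a}\<close>
  and \<open>{a+1..a+c}\<close>, in this order. For \<open>n = a + c\<close> the first run is empty and the permutation is not
  indecomposable when \<open>a\<close> and \<open>c\<close> are positive.
\<close>

definition block_word :: "nat \<Rightarrow> nat \<Rightarrow> nat \<Rightarrow> nat list" where
  "block_word n a c = rev [a + c + 1..<n + 1] @ rev [1..<a + 1] @ rev [a + 1..<a + c + 1]"

lemma length_block_word [simp]: "a + c \<le> n \<Longrightarrow> length (block_word n a c) = n"
  by (simp add: block_word_def del: upt_Suc)

lemma nth_rev_upt: "i < v - u \<Longrightarrow> rev [u..<v] ! i = v - 1 - i"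
  by (simp add: rev_nth del: upt_Suc)

lemma block_word_nth:
  assumes "a + c \<le> n" "i < n"
  shows "block_word n a c ! i =
    (if i < n - (a + c) then n - i else if i < n - c then n - c - i else n + a - i)"
  using assms unfolding block_word_def nth_append
  by (simp add: nth_rev_upt del: upt_Suc) linarith

lemma is_perm_block_word:
  assumes "a + c \<le> n"
  shows "is_perm (block_word n a c)"
proof -
  have "set (block_word n a c) = {1..n}"
    using assms by (auto simp: block_word_def simp del: upt_Suc)
  moreover have "distinct (block_word n a c)"
    by (auto simp: block_word_def simp del: upt_Suc)
  ultimately show ?thesis
    using assms by (simp add: is_perm_def permutations_of_set_def)
qed

lemma block_word_avoids:
  assumes "a + c \<le> n"
  shows "avoids (block_word n a c) [1, 2, 3]" "avoids (block_word n a c) [2, 3, 1]"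
proof -
  let ?w = "block_word n a c"
  \<comment> \<open>Ascents only occur from the second run to the third.\<close>
  have ascent: "n - (a + c) \<le> i \<and> i < n - c \<and> n - c \<le> j" if "i < j" "j < n" "?w ! i < ?w ! j" for i j
    using that assms by (auto simp: block_word_nth split: if_splits)
  show "avoids ?w [1, 2, 3]"
    unfolding avoids_def contains_123_iff
  proof clarify
    fix i j k assume "i < j" "j < k" "k < length ?w" "?w ! i < ?w ! j" "?w ! j < ?w ! k"
    then show False using ascent[of i j] ascent[of j k] assms by simp
  qed
  show "avoids ?w [2, 3, 1]"
    unfolding avoids_def contains_231_iff
  proof clarify
    fix i j k assume *: "i < j" "j < k" "k < length ?w" "?w ! k < ?w ! i" "?w ! i < ?w ! j"
    then have "n - (a + c) \<le> i" "i < n - c" "n - c \<le> j" "k < n" using ascent[of i j] assms by auto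
    then show False using * assms by (auto simp: block_word_nth split: if_splits)
  qed
qed

lemma indecomposable_if_hd_eq_length:
  assumes "is_perm xs" "xs \<noteq> []" "hd xs = length xs"
  shows "indecomposable xs"
  unfolding indecomposable_def
proof (intro conjI notI)
  assume "decomposable xs"
  then obtain \<rho> \<tau> where *: "is_perm \<rho>" "\<rho> \<noteq> []" "\<tau> \<noteq> []" "xs = perm_sum \<rho> \<tau>"
    by (auto simp: decomposable_def)
  have "hd \<rho> \<in> {1..length \<rho>}"
    using *(1,2) by (metis hd_in_set is_perm_def permutations_of_setD(1))
  moreover have "hd xs = hd \<rho>" "length xs = length \<rho> + length \<tau>"
    using * by (auto simp: perm_sum_def)
  ultimately show False using assms(3) *(3) by (cases \<tau>) auto
qed (use assms in auto)

lemma card_inversions_block_word: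
  assumes "a + c \<le> n"
  shows "card (inversions (block_word n a c)) = (n choose 2) - a * c"
proof -
  obtain r where n: "n = r + (a + c)" using assms by (metis add.commute le_Suc_ex)
  have dec: "card (inversions (rev [u..<v])) = (v - u) choose 2" for u v
    by (subst card_inversions_decreasing) (auto simp: sorted_wrt_rev)
  have "(\<Sum>x\<leftarrow>rev [1..<a + 1]. length (filter (\<lambda>y. y < x) (rev [a + 1..<a + c + 1]))) = 0"
    by (rule sum_list_filter_less) auto
  moreover have "(\<Sum>x\<leftarrow>rev [a + c + 1..<n + 1].
      length (filter (\<lambda>y. y < x) (rev [1..<a + 1] @ rev [a + 1..<a + c + 1]))) = r * (a + c)"
    by (subst sum_list_filter_greater) (auto simp: n)
  ultimately have "card (inversions (block_word n a c)) =
      (r choose 2) + ((a choose 2) + (c choose 2)) + r * (a + c)"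
    unfolding block_word_def card_inversions_append[of "rev [a + c + 1..<n + 1]"]
      card_inversions_append[of "rev [1..<a + 1]"] dec by (simp add: n)
  also have "\<dots> = (n choose 2) - a * c"
    unfolding n add_choose_two[of r] add_choose_two[of a] by simp
  finally show ?thesis .
qed

lemma inj_on_block_word: "inj_on (\<lambda>(n, a, c). block_word n a c) block_params"
proof (rule inj_onI)
  fix x y
  assume "x \<in> block_params" "y \<in> block_params"
    and "(\<lambda>(n, a, c). block_word n a c) x = (\<lambda>(n, a, c). block_word n a c) y"
  moreover obtain n a c where x: "x = (n, a, c)" by (cases x)
  moreover obtain n' a' c' where y: "y = (n', a', c')" by (cases y)
  ultimately have p: "(n, a, c) \<in> block_params" "(n', a', c') \<in> block_params"
    and eq: "block_word n a c = block_word n' a' c'"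
    by simp_all
  have n: "n' = n"
    using arg_cong[OF eq, of length] p by (simp add: block_params_def)
  \<comment> \<open>The last entry recovers \<open>a\<close>, and the position of the entry 1 recovers \<open>c\<close>.\<close>
  have last: "block_word n a c ! (n - 1) = a + 1" if "(n, a, c) \<in> block_params" for a c
    using that by (auto simp: block_params_def block_word_nth)
  have one: "block_word n a c ! (n - 1 - c) = 1" if "(n, a, c) \<in> block_params" for a c
    using that by (auto simp: block_params_def block_word_nth)
  have "a' = a" using last[of a c] last[of a' c'] p eq n by simp
  moreover have "c' = c"
  proof -
    have "distinct (block_word n a c)" "length (block_word n a c) = n"
      using is_perm_block_word[of a c n] p
      by (auto simp: block_params_def is_perm_def permutations_of_set_def)
    moreover have "n - 1 - c < n" "n - 1 - c' < n" using p n by (auto simp: block_params_def)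
    ultimately have "n - 1 - c = n - 1 - c'"
      using one[of a c] one[of a' c'] p eq n by (metis nth_eq_iff_index_eq)
    then show ?thesis using p n by (auto simp: block_params_def)
  qed
  ultimately show "x = y" using x y n by simp
qed

text \<open>
  If the maximum \<open>n\<close> is not in front, then \<open>ys\<close> and \<open>n # zs\<close> are themselves the second and third
  decreasing runs, the first run being empty.
\<close>

lemma avoider_split_at_max:
  assumes xs: "xs = ys @ n # zs" and n: "n = length xs" and perm: "is_perm xs"
    and av: "avoids xs [1, 2, 3]" "avoids xs [2, 3, 1]" and ys: "ys \<noteq> []"
  shows "xs = block_word n (length ys) (Suc (length zs))"
proof -
  let ?m = "length ys"
  have d: "distinct xs" and s: "set xs = {1..n}"
    using perm n by (auto simp: is_perm_def permutations_of_set_def)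
  have no123: "\<not> (xs ! i < xs ! j \<and> xs ! j < xs ! k)" if "i < j" "j < k" "k < n" for i j k
    using av(1) that n unfolding avoids_def contains_123_iff by blast
  have no231: "\<not> (xs ! k < xs ! i \<and> xs ! i < xs ! j)" if "i < j" "j < k" "k < n" for i j k
    using av(2) that n unfolding avoids_def contains_231_iff by blast
  have ne: "xs ! i \<noteq> xs ! j" if "i < j" "j < n" for i j
    using d that n by (simp add: nth_eq_iff_index_eq)
  have len: "n = ?m + Suc (length zs)" using arg_cong[OF xs, of length] n by simp
  have nth_ys: "xs ! i = ys ! i" if "i < ?m" for i using that by (simp add: xs nth_append)
  have nth_zs: "xs ! (?m + j) = (n # zs) ! j" for j by (simp add: xs nth_append)
  have max: "xs ! ?m = n" by (simp add: xs)
  have lt: "xs ! i < n" if "i < n" "i \<noteq> ?m" for i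
  proof -
    have "xs ! i \<noteq> xs ! ?m" using d that n len by (subst nth_eq_iff_index_eq) auto
    moreover have "xs ! i \<in> {1..n}" using s n that(1) by (metis nth_mem)
    ultimately show ?thesis using max by auto
  qed
  \<comment> \<open>An ascent before \<open>n\<close> would form a 123 together with \<open>n\<close>.\<close>
  have ys_dec: "xs ! j < xs ! i" if "i < j" "j < ?m" for i j
    using no123[of i j ?m] lt[of j] ne[of i j] max that len by fastforce
  \<comment> \<open>Otherwise the entries at \<open>i\<close> and \<open>k\<close> would form a 231 with \<open>n\<close> in the middle.\<close>
  have ys_zs: "xs ! i < xs ! k" if "i < ?m" "?m < k" "k < n" for i k
    using no231[of i ?m k] lt[of i] ne[of i k] max that len by fastforce
  \<comment> \<open>An ascent after \<open>n\<close> would form a 123 with the first entry, which comes before \<open>n\<close>.\<close>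
  have zs_dec: "xs ! j < xs ! i" if "?m < i" "i < j" "j < n" for i j
    using no123[of 0 i j] ys_zs[of 0 i] ne[of i j] ys that len by fastforce
  have "sorted_wrt (\<ge>) ys"
    unfolding sorted_wrt_iff_nth_less using ys_dec nth_ys
    by (metis order.strict_implies_order order.strict_trans)
  moreover have "sorted_wrt (\<ge>) (n # zs)"
    unfolding sorted_wrt_iff_nth_less
  proof clarify
    fix i j assume ij: "i < j" "j < length (n # zs)"
    have "xs ! (?m + j) \<le> xs ! (?m + i)"
      using ij zs_dec[of "?m + i" "?m + j"] lt[of "?m + j"] max len by (cases "i = 0") auto
    then show "(n # zs) ! j \<le> (n # zs) ! i" by (simp only: nth_zs)
  qed
  moreover have "y \<le> z" if "y \<in> set ys" "z \<in> set (n # zs)" for y z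
  proof -
    obtain i where i: "i < ?m" "y = ys ! i" using \<open>y \<in> set ys\<close> by (metis in_set_conv_nth)
    obtain j where j: "j < Suc (length zs)" "z = (n # zs) ! j" using \<open>z \<in> set (n # zs)\<close>
      by (metis in_set_conv_nth length_Cons)
    have "xs ! i \<le> xs ! (?m + j)"
      using ys_zs[of i "?m + j"] lt[of i] i j max len by (cases "j = 0") auto
    then show ?thesis using i j by (simp only: nth_ys nth_zs)
  qed
  ultimately have "sorted (rev ys @ rev (n # zs))"
    unfolding sorted_append by (auto simp: sorted_wrt_rev sorted_append)
  \<comment> \<open>Reversing both runs sorts the word, which must then be the identity permutation.\<close>
  moreover have "distinct (rev ys @ rev (n # zs))" "set (rev ys @ rev (n # zs)) = {1..n}"
    using d s by (auto simp: xs)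
  ultimately have id: "rev ys @ rev (n # zs) = [1..<n + 1]"
    by (intro sorted_distinct_set_unique) (auto simp del: upt_Suc)
  have "rev ys = take ?m [1..<n + 1]" "rev (n # zs) = drop ?m [1..<n + 1]"
    unfolding id[symmetric] by simp_all
  then have "rev ys = [1..<?m + 1]" "rev (n # zs) = [?m + 1..<?m + Suc (length zs) + 1]"
    by (simp_all add: len take_upt drop_upt del: upt_Suc)
  then have "ys = rev [1..<?m + 1]" "n # zs = rev [?m + 1..<?m + Suc (length zs) + 1]"
    by (metis rev_rev_ident)+
  moreover have "rev [?m + Suc (length zs) + 1..<n + 1] = []" using len by simp
  ultimately show ?thesis unfolding block_word_def xs by (metis append_Nil)
qed

lemma contains_Cons: "contains xs \<tau> \<Longrightarrow> contains (x # xs) \<tau>"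
  unfolding contains_def
proof (elim exE conjE)
  fix f :: "nat \<Rightarrow> nat"
  assume "strict_mono_on {..<length \<tau>} f" "f ` {..<length \<tau>} \<subseteq> {..<length xs}"
    "\<forall>a<length \<tau>. \<forall>b<length \<tau>. xs ! f a < xs ! f b \<longleftrightarrow> \<tau> ! a < \<tau> ! b"
  then show "\<exists>f. strict_mono_on {..<length \<tau>} f \<and> f ` {..<length \<tau>} \<subseteq> {..<length (x # xs)} \<and>
      (\<forall>a<length \<tau>. \<forall>b<length \<tau>. (x # xs) ! f a < (x # xs) ! f b \<longleftrightarrow> \<tau> ! a < \<tau> ! b)"
    by (intro exI[of _ "Suc \<circ> f"]) (auto simp: strict_mono_on_def)
qed

lemma avoider_is_block_word:
  "is_perm xs \<Longrightarrow> avoids xs [1, 2, 3] \<Longrightarrow> avoids xs [2, 3, 1] \<Longrightarrow>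
    \<exists>a c. a + c \<le> length xs \<and> (a = 0 \<longleftrightarrow> c = 0) \<and> xs = block_word (length xs) a c"
proof (induction "length xs" arbitrary: xs)
  case 0
  then show ?case by (intro exI[of _ 0]) (simp add: block_word_def)
next
  case (Suc n)
  have d: "distinct xs" and s: "set xs = {1..length xs}"
    using Suc.prems by (auto simp: is_perm_def permutations_of_set_def)
  then have "length xs \<in> set xs" using Suc.hyps(2) by simp
  then obtain ys zs where xs: "xs = ys @ length xs # zs" by (meson split_list)
  then have len: "length xs = length (ys @ length xs # zs)" by (rule arg_cong)
  show ?case
  proof (cases "ys = []")
    case True
    then have xs: "xs = Suc n # zs" using xs Suc.hyps(2) by simp
    have zs: "length zs = n" using xs Suc.hyps(2) by (metis length_Cons nat.inject)
    have "Suc n \<notin> set zs" using d xs by simp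
    moreover have "insert (Suc n) (set zs) = {1..Suc n}" using s xs Suc.hyps(2) by (metis list.set(2))
    ultimately have "set zs = {1..Suc n} - {Suc n}" by blast
    also have "\<dots> = {1..n}" by auto
    finally have "is_perm zs" using d xs zs by (simp add: is_perm_def permutations_of_set_def)
    moreover have "avoids zs [1, 2, 3]" "avoids zs [2, 3, 1]"
      using Suc.prems contains_Cons[of zs _ "Suc n"] unfolding avoids_def xs by blast+
    ultimately obtain a c where "a + c \<le> n" "a = 0 \<longleftrightarrow> c = 0" "zs = block_word n a c"
      using Suc.hyps(1)[of zs] zs by blast
    then show ?thesis using xs zs
      by (intro exI[of _ a] exI[of _ c]) (simp add: block_word_def)
  next
    case False
    have "xs = block_word (length xs) (length ys) (Suc (length zs))"
      by (rule avoider_split_at_max[OF xs refl Suc.prems False])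
    moreover have "length xs = length ys + Suc (length zs)" using len by simp
    ultimately show ?thesis
      using False by (intro exI[of _ "length ys"] exI[of _ "Suc (length zs)"]) simp
  qed
qed

lemma indecomposable_avoider_is_block_word:
  assumes "indecomposable xs" "avoids xs [1, 2, 3]" "avoids xs [2, 3, 1]"
  shows "\<exists>n a c. (n, a, c) \<in> block_params \<and> xs = block_word n a c"
proof -
  have perm: "is_perm xs" and ne: "xs \<noteq> []" and nd: "\<not> decomposable xs"
    using assms(1) by (auto simp: indecomposable_def)
  obtain a c where ac: "a + c \<le> length xs" "a = 0 \<longleftrightarrow> c = 0" "xs = block_word (length xs) a c"
    using avoider_is_block_word assms perm by blast
  have "a + c \<noteq> length xs"
  proof
    assume eq: "a + c = length xs"
    then have "a > 0" "c > 0" using ne ac(2) by auto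
    have "xs = rev [1..<a + 1] @ rev [a + 1..<a + c + 1]"
      using ac(3) eq by (simp add: block_word_def)
    then have "take a xs = rev [1..<a + 1]" by simp
    then have "set (take a xs) = {1..a}" by (auto simp del: upt_Suc)
    then show False using decomposable_if_prefix[OF perm \<open>a > 0\<close>] eq \<open>c > 0\<close> nd by simp
  qed
  then show ?thesis using ac by (intro exI[of _ "length xs"] exI[of _ a] exI[of _ c])
      (simp add: block_params_def)
qed

lemma block_word_indecomposable:
  assumes "(n, a, c) \<in> block_params"
  shows "indecomposable (block_word n a c)"
proof (rule indecomposable_if_hd_eq_length)
  show "is_perm (block_word n a c)"
    using assms by (intro is_perm_block_word) (simp add: block_params_def)
  have len: "length (block_word n a c) = n" and "n > 0" using assms by (auto simp: block_params_def)
  then show "block_word n a c \<noteq> []" by auto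
  then show "hd (block_word n a c) = length (block_word n a c)"
    using assms len \<open>n > 0\<close> by (simp add: hd_conv_nth block_word_nth block_params_def)
qed

lemma card_indec_avoiders:
  "card (indec_avoiders k {[1, 2, 3], [2, 3, 1]}) = card (params_of_weight k)"
proof -
  have "indec_avoiders k {[1, 2, 3], [2, 3, 1]} = (\<lambda>(n, a, c). block_word n a c) ` params_of_weight k"
  proof (intro equalityI subsetI)
    fix xs assume "xs \<in> indec_avoiders k {[1, 2, 3], [2, 3, 1]}"
    then have xs: "indecomposable xs" "avoids xs [1, 2, 3]" "avoids xs [2, 3, 1]"
        "card (inversions xs) = k"
      by (auto simp: indec_avoiders_def)
    then obtain n a c where p: "(n, a, c) \<in> block_params" "xs = block_word n a c"
      using indecomposable_avoider_is_block_word by blast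
    then have "(n choose 2) - a * c = k"
      using xs card_inversions_block_word[of a c n] by (simp add: block_params_def)
    then show "xs \<in> (\<lambda>(n, a, c). block_word n a c) ` params_of_weight k"
      using p by (intro image_eqI[of _ _ "(n, a, c)"]) (auto simp: params_of_weight_def)
  next
    fix xs assume "xs \<in> (\<lambda>(n, a, c). block_word n a c) ` params_of_weight k"
    then obtain n a c where p: "(n, a, c) \<in> block_params" "(n choose 2) - a * c = k"
        and xs: "xs = block_word n a c"
      by (auto simp: params_of_weight_def)
    moreover from p have "a + c \<le> n" by (simp add: block_params_def)
    ultimately show "xs \<in> indec_avoiders k {[1, 2, 3], [2, 3, 1]}"
      using block_word_indecomposable block_word_avoids card_inversions_block_word
      by (simp add: indec_avoiders_def)
  qed
  moreover have "inj_on (\<lambda>(n, a, c). block_word n a c) (params_of_weight k)"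
    using inj_on_block_word by (rule inj_on_subset) (auto simp: params_of_weight_def)
  ultimately show ?thesis by (simp add: card_image)
qed


section \<open>The fountains\<close>

text \<open>
  The first \<open>a\<close> up-right diagonals and the last \<open>c\<close> up-left diagonals of the full fountain with
  \<open>n - 1\<close> coins in the bottom row: a rectangle at the apex of the triangle.
\<close>

definition corner :: "nat \<Rightarrow> nat \<Rightarrow> nat \<Rightarrow> (nat \<times> nat) set" where
  "corner n a c = {(h, p). p \<in> {1..a} \<and> p + h \<in> {n - c..n - 1}}"

text \<open>The full fountain with \<open>n - 1\<close> coins in the bottom row, without the rectangle at its apex.\<close>

definition cut_fountain :: "nat \<Rightarrow> nat \<Rightarrow> nat \<Rightarrow> (nat \<times> nat) set" where
  "cut_fountain n a c = full_fountain (n - 1) - corner n a c"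

lemma corner_subset: "a + c < n \<Longrightarrow> corner n a c \<subseteq> full_fountain (n - 1)"
  by (auto simp: corner_def full_fountain_def)

lemma card_corner:
  assumes "a + c < n"
  shows "card (corner n a c) = a * c"
proof -
  have "corner n a c = (\<lambda>(p, q). (q - p, p)) ` ({1..a} \<times> {n - c..n - 1})"
  proof (intro equalityI subsetI)
    fix x assume "x \<in> corner n a c"
    then show "x \<in> (\<lambda>(p, q). (q - p, p)) ` ({1..a} \<times> {n - c..n - 1})"
      by (auto simp: corner_def intro!: image_eqI[of _ _ "(snd x, snd x + fst x)"])
  qed (use assms in \<open>auto simp: corner_def\<close>)
  moreover have "inj_on (\<lambda>(p, q). (q - p, p)) ({1..a} \<times> {n - c..n - 1})"
    using assms by (auto simp: inj_on_def)
  ultimately show ?thesis using assms by (simp add: card_image)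
qed

lemma card_full_fountain: "card (full_fountain N) = Suc N choose 2"
proof (induction N)
  case 0
  have "full_fountain 0 = {}" by (auto simp: full_fountain_def)
  then show ?case by simp
next
  case (Suc N)
  \<comment> \<open>The last up-left diagonal.\<close>
  let ?D = "(\<lambda>p. (Suc N - p, p)) ` {1..Suc N}"
  have "full_fountain (Suc N) = full_fountain N \<union> ?D"
    by (auto simp: full_fountain_def image_iff)
  moreover have "full_fountain N \<inter> ?D = {}" by (auto simp: full_fountain_def)
  moreover have "card ?D = Suc N" by (subst card_image) (auto simp: inj_on_def)
  ultimately show ?case
    using Suc by (simp add: card_Un_disjoint finite_full_fountain Suc_choose_two)
qed

lemma card_cut_fountain:
  assumes "a + c < n"
  shows "card (cut_fountain n a c) = (n choose 2) - a * c"
proof -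
  have "card (cut_fountain n a c) = card (full_fountain (n - 1)) - card (corner n a c)"
    unfolding cut_fountain_def using corner_subset[OF assms] finite_full_fountain
    by (intro card_Diff_subset) (auto intro: finite_subset)
  then show ?thesis using assms card_corner[OF assms] card_full_fountain[of "n - 1"] by simp
qed

lemma is_fountain_cut_fountain:
  assumes "a + c < n"
  shows "is_fountain (n - 1) (cut_fountain n a c)"
  using assms unfolding is_fountain_def cut_fountain_def
  by (auto simp: full_fountain_def corner_def)

lemma is_rectangle_corner:
  assumes "(n, a, c) \<in> block_params"
  shows "is_rectangle (n - 1) (corner n a c)"
proof (cases "a = 0")
  case True
  then show ?thesis by (simp add: is_rectangle_def corner_def)
next
  case False
  then have ineqs: "1 \<le> a" "a \<le> n - c" "n - c \<le> n - 1"
    using assms by (auto simp: block_params_def)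
  show ?thesis unfolding is_rectangle_def corner_def
    by (rule disjI2, rule exI[of _ 1], rule exI[of _ a], rule exI[of _ "n - c"],
        rule exI[of _ "n - 1"])
      (use ineqs in simp)
qed

lemma fountain_bottom_unique:
  assumes "is_fountain M F" "is_fountain N F"
  shows "M = N"
proof -
  have "{p. (0, p) \<in> F} = {1..K}" if "is_fountain K F" for K
    using that by (auto simp: is_fountain_def full_fountain_def)
  then have "{1..M} = {1..N}" using assms by metis
  then show ?thesis by (metis card_atLeastAtMost diff_Suc_1)
qed

lemma inj_on_cut_fountain: "inj_on (\<lambda>(n, a, c). cut_fountain n a c) block_params"
proof (rule inj_onI)
  fix x y
  assume "x \<in> block_params" "y \<in> block_params"
    and "(\<lambda>(n, a, c). cut_fountain n a c) x = (\<lambda>(n, a, c). cut_fountain n a c) y"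
  moreover obtain n a c where x: "x = (n, a, c)" by (cases x)
  moreover obtain n' a' c' where y: "y = (n', a', c')" by (cases y)
  ultimately have p: "(n, a, c) \<in> block_params" "(n', a', c') \<in> block_params"
    and eq: "cut_fountain n a c = cut_fountain n' a' c'"
    by simp_all
  have "n - 1 = n' - 1"
    using fountain_bottom_unique is_fountain_cut_fountain[of a c n]
      is_fountain_cut_fountain[of a' c' n'] p eq by (auto simp: block_params_def)
  then have n: "n' = n" using p by (auto simp: block_params_def)
  have "corner n a c = full_fountain (n - 1) - cut_fountain n a c"
    "corner n a' c' = full_fountain (n - 1) - cut_fountain n a' c'"
    using corner_subset[of a c n] corner_subset[of a' c' n] p n
    by (auto simp: block_params_def cut_fountain_def)
  then have eq': "corner n a c = corner n a' c'" using eq n by simp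
  \<comment> \<open>Its coin on the up-right diagonal \<open>a\<close> and the up-left diagonal \<open>n - 1\<close> determines \<open>a\<close>, and
    its coin on the up-right diagonal 1 and the up-left diagonal \<open>n - c\<close> determines \<open>c\<close>.\<close>
  have le: "a \<le> a' \<and> c \<le> c'"
    if "(n, a, c) \<in> block_params" "(n, a', c') \<in> block_params"
      "corner n a c = corner n a' c'" for a c a' c'
  proof (cases "a = 0")
    case True
    then show ?thesis using that by (auto simp: block_params_def)
  next
    case False
    then have "(n - 1 - a, a) \<in> corner n a c" "(n - c - 1, 1) \<in> corner n a c"
      using that(1) by (auto simp: corner_def block_params_def)
    then have "(n - 1 - a, a) \<in> corner n a' c'" "(n - c - 1, 1) \<in> corner n a' c'"
      using that(3) by auto
    then show ?thesis using that(1,2) by (auto simp: corner_def block_params_def)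
  qed
  show "x = y"
    using x y le[of a c a' c'] le[of a' c' a c] p n eq' by auto
qed

lemma rectangle_fountain_is_cut_fountain:
  assumes fount: "is_fountain N F" and rect: "is_rectangle N (full_fountain N - F)"
  shows "\<exists>n a c. (n, a, c) \<in> block_params \<and> F = cut_fountain n a c"
proof (cases "full_fountain N - F = {}")
  case True
  then have "F = full_fountain N" using fount by (auto simp: is_fountain_def)
  then show ?thesis by (intro exI[of _ "Suc N"] exI[of _ 0])
      (simp add: block_params_def cut_fountain_def corner_def)
next
  case False
  then obtain a1 a2 b1 b2 where ab: "1 \<le> a1" "a1 \<le> a2" "a2 \<le> b1" "b1 \<le> b2" "b2 \<le> N"
      and R: "full_fountain N - F = {(h, p). p \<in> {a1..a2} \<and> p + h \<in> {b1..b2}}"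
    using rect unfolding is_rectangle_def by auto
  have missing: "(h, p) \<notin> F \<longleftrightarrow> p \<in> {a1..a2} \<and> p + h \<in> {b1..b2}" if "1 \<le> p" "p + h \<le> N" for h p
  proof -
    have "(h, p) \<notin> F \<longleftrightarrow> (h, p) \<in> full_fountain N - F" using that by (simp add: full_fountain_def)
    then show ?thesis unfolding R by simp
  qed
  have down: "(h, p) \<in> F" "(h, Suc p) \<in> F" if "(Suc h, p) \<in> F" for h p
    using fount that unfolding is_fountain_def
    by (metis Suc_eq_plus1 diff_Suc_1 le_add2)+
  \<comment> \<open>The missing coins are closed upwards, so the rectangle reaches the apex; the bottom row is
    full, so it stays above the bottom row.\<close>
  have a1: "a1 = 1"
  proof (rule ccontr)
    assume "a1 \<noteq> 1"
    then obtain p where p: "a1 = Suc p" "p \<ge> 1" using ab by (cases a1) auto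
    have "(Suc (b1 - a1), p) \<in> F" using missing[of p "Suc (b1 - a1)"] p ab by auto
    then have "(b1 - a1, a1) \<in> F" using down p by blast
    then show False using missing[of a1 "b1 - a1"] ab by auto
  qed
  have b2: "b2 = N"
  proof (rule ccontr)
    assume "b2 \<noteq> N"
    then have "(Suc (b2 - a2), a2) \<in> F" using missing[of a2 "Suc (b2 - a2)"] ab by auto
    then have "(b2 - a2, a2) \<in> F" using down by blast
    then show False using missing[of a2 "b2 - a2"] ab by auto
  qed
  have "a2 \<noteq> b1"
  proof
    assume "a2 = b1"
    then have "(0, a2) \<notin> F" using missing[of a2 0] ab by auto
    then show False using fount ab by (auto simp: is_fountain_def)
  qed
  then have "(Suc N, a2, Suc N - b1) \<in> block_params" using ab by (auto simp: block_params_def)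
  moreover have "full_fountain N - F = corner (Suc N) a2 (Suc N - b1)"
    unfolding R corner_def using a1 b2 ab by auto
  then have "F = cut_fountain (Suc N) a2 (Suc N - b1)"
    using fount unfolding cut_fountain_def is_fountain_def by auto
  ultimately show ?thesis by blast
qed

lemma card_rectangle_fountains: "card (rectangle_fountains k) = card (params_of_weight k)"
proof -
  have "rectangle_fountains k = (\<lambda>(n, a, c). cut_fountain n a c) ` params_of_weight k"
  proof (intro equalityI subsetI)
    fix F assume "F \<in> rectangle_fountains k"
    then obtain N where "card F = k" "is_fountain N F" "is_rectangle N (full_fountain N - F)"
      by (auto simp: rectangle_fountains_def)
    moreover from this obtain n a c where p: "(n, a, c) \<in> block_params" "F = cut_fountain n a c"
      using rectangle_fountain_is_cut_fountain by blast
    ultimately have "(n choose 2) - a * c = k"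
      using card_cut_fountain[of a c n] by (simp add: block_params_def)
    then show "F \<in> (\<lambda>(n, a, c). cut_fountain n a c) ` params_of_weight k"
      using p by (intro image_eqI[of _ _ "(n, a, c)"]) (auto simp: params_of_weight_def)
  next
    fix F assume "F \<in> (\<lambda>(n, a, c). cut_fountain n a c) ` params_of_weight k"
    then obtain n a c where p: "(n, a, c) \<in> block_params" "(n choose 2) - a * c = k"
        and F: "F = cut_fountain n a c"
      by (auto simp: params_of_weight_def)
    then have lt: "a + c < n" by (simp add: block_params_def)
    have "full_fountain (n - 1) - F = corner n a c"
      using corner_subset[OF lt] unfolding F cut_fountain_def by blast
    then have "is_rectangle (n - 1) (full_fountain (n - 1) - F)"
      using is_rectangle_corner[OF p(1)] by simp
    then show "F \<in> rectangle_fountains k"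
      using is_fountain_cut_fountain[OF lt] card_cut_fountain[OF lt] p F
      by (auto simp: rectangle_fountains_def)
  qed
  moreover have "inj_on (\<lambda>(n, a, c). cut_fountain n a c) (params_of_weight k)"
    using inj_on_cut_fountain by (rule inj_on_subset) (auto simp: params_of_weight_def)
  ultimately show ?thesis by (simp add: card_image)
qed


section \<open>The generating function\<close>

text \<open>
  The number of coins in the union of two full fountains with bottom rows of lengths \<open>i\<close> and \<open>j\<close>
  that overlap in a full fountain with bottom row of length \<open>l\<close>.
\<close>

definition two_triangles_size :: "nat \<Rightarrow> nat \<Rightarrow> nat \<Rightarrow> nat" where
  "two_triangles_size i j l = (i + 1 choose 2) + (j + 1 choose 2) - (l + 1 choose 2)"

lemma two_triangles_size_eq:
  "two_triangles_size (l + a) (l + c) l = ((l + a + c + 1) choose 2) - a * c"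
proof -
  have overlap: "(m + a choose 2) + (m + c choose 2) + a * c
      = (m + a + c choose 2) + (m choose 2)" for m
    by (simp add: add_choose_two distrib_right)
  have shift: "l + a + 1 = l + 1 + a" "l + c + 1 = l + 1 + c" "l + a + c + 1 = l + 1 + a + c"
    by simp_all
  show ?thesis
    unfolding two_triangles_size_def shift using overlap[of "l + 1"] by linarith
qed

lemma two_triangles_size_ge:
  assumes "l < i" "l < j"
  shows "i \<le> two_triangles_size i j l" "j \<le> two_triangles_size i j l"
proof -
  have "l + 1 choose 2 \<le> i + 1 choose 2" "l + 1 choose 2 \<le> j + 1 choose 2"
    using assms by (auto intro: binomial_right_mono)
  then show "i \<le> two_triangles_size i j l" "j \<le> two_triangles_size i j l"
    using le_Suc_choose_2[of i] le_Suc_choose_2[of j] by (auto simp: two_triangles_size_def)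
qed

text \<open>
  A triple \<open>(n, 0, 0)\<close> corresponds to \<open>i = n\<close>; a triple with \<open>a, c \<ge> 1\<close> corresponds to
  \<open>(l + a, l + c, l)\<close> with \<open>l = n - 1 - a - c\<close>.
\<close>

lemma card_params_of_weight:
  "card (params_of_weight k) = card {i. 1 \<le> i \<and> i choose 2 = k} +
    card {(i, j, l). l < i \<and> l < j \<and> two_triangles_size i j l = k}"
proof -
  let ?S = "{i. 1 \<le> i \<and> i choose 2 = k}"
  let ?T = "{(i, j, l). l < i \<and> l < j \<and> two_triangles_size i j l = k}"
  let ?f = "\<lambda>i. (i, 0::nat, 0::nat)" and ?g = "\<lambda>(i, j, l). (i + j - l + 1, i - l, j - l)"
  have weight: "((i + j - l + 1) choose 2) - (i - l) * (j - l) = two_triangles_size i j l"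
    if "l < i" "l < j" for i j l
    using two_triangles_size_eq[of l "i - l" "j - l"] that by simp
  have "params_of_weight k = ?f ` ?S \<union> ?g ` ?T"
  proof (intro equalityI subsetI)
    fix x assume "x \<in> params_of_weight k"
    then obtain n a c where x: "x = (n, a, c)" "a + c < n" "a = 0 \<longleftrightarrow> c = 0"
        "(n choose 2) - a * c = k"
      by (auto simp: params_of_weight_def block_params_def)
    show "x \<in> ?f ` ?S \<union> ?g ` ?T"
    proof (cases "a = 0")
      case True
      then show ?thesis using x by auto
    next
      case False
      define l where "l = n - 1 - a - c"
      have n: "n = l + a + c + 1" using x(2) by (simp add: l_def)
      have "(l + a, l + c, l) \<in> ?T" using False x two_triangles_size_eq[of l a c] n by simp
      then show ?thesis using x(1) n by (intro UnI2 image_eqI[of _ _ "(l + a, l + c, l)"]) auto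
    qed
  next
    fix x assume "x \<in> ?f ` ?S \<union> ?g ` ?T"
    then show "x \<in> params_of_weight k"
      using weight by (auto simp: params_of_weight_def block_params_def)
  qed
  moreover have "?f ` ?S \<inter> ?g ` ?T = {}" by auto
  moreover have "finite ?S"
  proof (rule finite_subset)
    show "?S \<subseteq> {..Suc k}"
    proof
      fix i assume "i \<in> ?S"
      then show "i \<in> {..Suc k}" using le_Suc_choose_2[of "i - 1"] by (cases i) auto
    qed
  qed simp
  moreover have "finite ?T"
    by (rule finite_subset[of _ "{..k} \<times> {..k} \<times> {..k}"])
      (auto dest: two_triangles_size_ge)
  moreover have "inj_on ?f ?S" "inj_on ?g ?T" by (auto simp: inj_on_def)
  ultimately show ?thesis by (simp add: card_Un_disjoint card_image)
qed

text \<open>Only finitely many terms contribute to a given coefficient.\<close>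

lemma fps_nth_infsum_from_1:
  fixes F :: "nat \<Rightarrow> int fps"
  assumes "F summable_on {1..}" "\<And>i. 1 \<le> i \<Longrightarrow> M < i \<Longrightarrow> fps_nth (F i) n = 0"
  shows "fps_nth (infsum F {1..}) n = (\<Sum>i=1..M. fps_nth (F i) n)"
proof -
  have "i \<le> M" if "1 \<le> i" "fps_nth (F i) n \<noteq> 0" for i
    using assms(2)[of i] that by linarith
  then show ?thesis
    unfolding fps_infsum_nth[OF assms(1)] by (intro sum.mono_neutral_left) auto
qed

lemma fps_nth_triangle_series:
  "fps_nth (\<Sum>\<^sub>\<infinity>i\<in>{1..}. fps_X ^ (i choose 2)) k = int (card {i. 1 \<le> i \<and> i choose 2 = k})"
proof -
  have bound: "i \<le> Suc k" if "i choose 2 = k" for i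
    using that le_Suc_choose_2[of "i - 1"] by (cases i) auto
  have "fps_nth (\<Sum>\<^sub>\<infinity>i\<in>{1..}. fps_X ^ (i choose 2)) k
      = (\<Sum>i=1..Suc k. fps_nth (fps_X ^ (i choose 2) :: int fps) k)"
    by (rule fps_nth_infsum_from_1[OF summable_first_series])
      (use bound in \<open>force simp: fps_X_power_nth\<close>)
  also have "\<dots> = (\<Sum>i=1..Suc k. if i choose 2 = k then 1 else 0)"
    by (rule sum.cong) (auto simp: fps_X_power_nth)
  also have "\<dots> = int (card ({1..Suc k} \<inter> {i. i choose 2 = k}))"
    by (subst sum.If_cases) auto
  also have "{1..Suc k} \<inter> {i. i choose 2 = k} = {i. 1 \<le> i \<and> i choose 2 = k}"
    using bound by auto
  finally show ?thesis .
qed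

lemma fps_nth_two_triangles_series:
  "fps_nth (\<Sum>\<^sub>\<infinity>i\<in>{1..}. \<Sum>\<^sub>\<infinity>j\<in>{1..}. inner_term i j) k =
    int (card {(i, j, l). l < i \<and> l < j \<and> two_triangles_size i j l = k})"
proof -
  let ?D = "SIGMA i:{1..k}. SIGMA j:{1..k}. {0..min i j - 1}"
  have inner: "fps_nth (\<Sum>\<^sub>\<infinity>j\<in>{1..}. inner_term i j) k = (\<Sum>j=1..k. fps_nth (inner_term i j) k)"
    if "1 \<le> i" for i
    using that by (intro fps_nth_infsum_from_1 summable_inner_series inner_term_nth_eq_0) auto
  have "fps_nth (\<Sum>\<^sub>\<infinity>i\<in>{1..}. \<Sum>\<^sub>\<infinity>j\<in>{1..}. inner_term i j) k
      = (\<Sum>i=1..k. fps_nth (\<Sum>\<^sub>\<infinity>j\<in>{1..}. inner_term i j) k)"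
  proof (rule fps_nth_infsum_from_1[OF summable_outer_series])
    fix i assume "1 \<le> i" "k < i"
    then show "fps_nth (\<Sum>\<^sub>\<infinity>j\<in>{1..}. inner_term i j) k = 0"
      unfolding inner[OF \<open>1 \<le> i\<close>] by (intro sum.neutral) (simp add: inner_term_nth_eq_0)
  qed
  also have "\<dots> = (\<Sum>i=1..k. \<Sum>j=1..k. fps_nth (inner_term i j) k)"
    by (intro sum.cong refl inner) auto
  also have "\<dots> = (\<Sum>i=1..k. \<Sum>j=1..k. \<Sum>l = 0..min i j - 1.
      if two_triangles_size i j l = k then 1 else 0)"
    by (intro sum.cong refl)
      (auto simp: inner_term_def fps_sum_nth fps_X_power_nth two_triangles_size_def intro!: sum.cong)
  also have "\<dots> = (\<Sum>(i, j, l)\<in>?D. if two_triangles_size i j l = k then 1 else 0)"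
    by (simp add: sum.Sigma)
  also have "\<dots> = (\<Sum>x\<in>?D. if x \<in> {(i, j, l). two_triangles_size i j l = k} then 1 else 0)"
    by (intro sum.cong) auto
  also have "\<dots> = int (card (?D \<inter> {(i, j, l). two_triangles_size i j l = k}))"
    by (subst sum.If_cases) auto
  also have "?D \<inter> {(i, j, l). two_triangles_size i j l = k} =
      {(i, j, l). l < i \<and> l < j \<and> two_triangles_size i j l = k}"
    by (auto dest: two_triangles_size_ge)
  finally show ?thesis .
qed

theorem theorem12:
  shows "(\<forall>k. card (indec_avoiders k {[1, 2, 3], [2, 3, 1]}) = card (rectangle_fountains k)) \<and>
    Abs_fps (\<lambda>k. int (card (indec_avoiders k {[1, 2, 3], [2, 3, 1]}))) =
      (\<Sum>\<^sub>\<infinity>i\<in>{1..}. fps_X ^ (i choose 2)) +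
      (\<Sum>\<^sub>\<infinity>i\<in>{1..}. \<Sum>\<^sub>\<infinity>j\<in>{1..}. \<Sum>l = 0..min i j - 1.
         fps_X ^ ((i + 1 choose 2) + (j + 1 choose 2) - (l + 1 choose 2)))"
  unfolding inner_term_def[symmetric]
proof (intro conjI allI fps_ext)
  fix k
  show "card (indec_avoiders k {[1, 2, 3], [2, 3, 1]}) = card (rectangle_fountains k)"
    by (simp only: card_indec_avoiders card_rectangle_fountains)
  show "fps_nth (Abs_fps (\<lambda>k. int (card (indec_avoiders k {[1, 2, 3], [2, 3, 1]})))) k =
      fps_nth ((\<Sum>\<^sub>\<infinity>i\<in>{1..}. fps_X ^ (i choose 2)) + (\<Sum>\<^sub>\<infinity>i\<in>{1..}. \<Sum>\<^sub>\<infinity>j\<in>{1..}. inner_term i j)) k"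
    by (simp only: fps_nth_Abs_fps fps_add_nth card_indec_avoiders card_params_of_weight
        fps_nth_triangle_series fps_nth_two_triangles_series of_nat_add)
qed

end
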